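(* Let $G$ be a finite simple connected graph with $n$ vertices that is not a tree, with a designated sink vertex. Suppose that $G$ has degree sequence $d_1\le\cdots\le d_{n-1}\le d_n$ and set $d_*=d_{n-1}$. Then the spectral gap $\gamma_d$ of the discrete time sandpile chain on $G$ satisfies $$\gamma_d\ge\frac{8}{d_*^2\,n}.$$
   Context: A multiplicative harmonic function on $G=(V,E)$ with sink $s$ is a function $h:V\to\{z\in\mathbb{C}:|z|=1\}$ with $h(s)=1$ and $h(v)^{\deg(v)}=\prod_{w\sim v}h(w)$ for all $v\in V$. $\mathcal{H}$ is the finite set of all such functions. For $h\in\mathcal{H}$ put $\lambda_h=\frac1n\sum_{v\in V}h(v)$; these are the eigenvalues of the sandpile chain. The discrete time spectral gap is $\gamma_d=\min\{1-|\lambda_h|:h\in\mathcal{H},\,h\not\equiv1\}$. *)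

theory Defs
  imports Complex_Main "HOL-Library.FuncSet" "HOL-Library.Multiset" "Graph_Theory.Graph_Theory"
begin

text \<open>
  A finite simple undirected graph is a \<open>pair_graph\<close>: a finite, loop-free digraph without
  parallel arcs whose arc relation is symmetric, so that an edge is a pair of opposite arcs.
\<close>

definition neighbours :: "'a pair_pre_digraph \<Rightarrow> 'a \<Rightarrow> 'a set" where
  "neighbours G v = {w. (v, w) \<in> parcs G}"

definition vertex_degree :: "'a pair_pre_digraph \<Rightarrow> 'a \<Rightarrow> nat" where
  "vertex_degree G v = card (neighbours G v)"

text \<open>
  The list is indexed from 0: the entry at position \<open>i\<close> is \<open>d\<close> with index \<open>i + 1\<close>.
\<close>

definition degree_sequence :: "'a pair_pre_digraph \<Rightarrow> nat list" where
  "degree_sequence G = sorted_list_of_multiset (image_mset (vertex_degree G) (mset_set (pverts G)))"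

text \<open>
  The library predicate \<open>tree\<close> counts the arc walk \<open>u, v, u\<close> as a cycle, so no symmetric digraph
  with an edge satisfies it. Cycles of a simple undirected graph have length at least 3.
\<close>

definition undirected_tree :: "'a pair_pre_digraph \<Rightarrow> bool" where
  "undirected_tree G \<longleftrightarrow>
     Digraph_Component.connected (with_proj G) \<and>
     \<not> (\<exists>p. pre_digraph.cycle (with_proj G) p \<and> 3 \<le> length p)"

text \<open>
  Functions on the vertex set are extensional, so that each one is represented exactly once.
\<close>

definition mult_harmonic :: "'a pair_pre_digraph \<Rightarrow> 'a \<Rightarrow> ('a \<Rightarrow> complex) set" where
  "mult_harmonic G s =
     {h \<in> pverts G \<rightarrow>\<^sub>E {z. cmod z = 1}.
        h s = 1 \<and> (\<forall>v\<in>pverts G. h v ^ vertex_degree G v = (\<Prod>w\<in>neighbours G v. h w))}"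

definition sandpile_eigenvalue :: "'a pair_pre_digraph \<Rightarrow> ('a \<Rightarrow> complex) \<Rightarrow> complex" where
  "sandpile_eigenvalue G h = 1 / of_nat (card (pverts G)) * (\<Sum>v\<in>pverts G. h v)"

definition discrete_spectral_gap :: "'a pair_pre_digraph \<Rightarrow> 'a \<Rightarrow> real" where
  "discrete_spectral_gap G s =
     Min {1 - cmod (sandpile_eigenvalue G h) | h.
            h \<in> mult_harmonic G s \<and> \<not> (\<forall>v\<in>pverts G. h v = 1)}"

end

theory Submission
  imports Defs "HOL-Library.Real_Mod" "HOL-Analysis.Convex"
begin

text \<open>
  Rotate \<open>h\<close> by a unit \<open>\<omega>\<close> so that its sum becomes a nonnegative real, and write
  \<open>h = \<omega> cis \<theta>\<close> with \<open>\<theta>\<close> in the interval from \<open>-\<pi>\<close> to \<open>\<pi>\<close>. The Laplacian of \<open>\<theta>\<close> takes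
  values in \<open>2\<pi>\<int>\<close>, sums to zero, and vanishes identically only if \<open>h = 1\<close>; so it is nonzero at two
  vertices, one of which has degree \<open>d \<le> d\<^sub>*\<close>. This vertex \<open>v\<close> has a neighbour \<open>w\<close> with
  \<open>\<bar>\<theta> v\<bar> + \<bar>\<theta> w\<bar> \<ge> 2\<pi>/d\<close>, so these two vertices alone lower the sum of the \<open>n\<close> cosines to at most
  \<open>n - 2 + 2 cos (\<pi>/d) \<le> n - 8/d\<^sup>2\<close>.

  The minimum is over a finite set because \<open>h\<close> is determined by the Laplacian of its argument, and
  over a nonempty set because the potential of a unit current along an edge of a cycle is not
  integral and exponentiates to a nontrivial multiplicative harmonic function.
\<close>

section \<open>Trigonometric estimates\<close>

text \<open>Concavity keeps \<open>sin\<close> above its chord from 0 to \<open>pi/4\<close>;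
  squaring and the half-angle formula finish. The constant 4 gives equality at
  \<open>y = 1/2\<close>.\<close>

lemma cos_pi_mult_le:
  fixes y :: real
  assumes "0 \<le> y" "y \<le> 1/2"
  shows "cos (pi * y) \<le> 1 - 4 * y\<^sup>2"
proof -
  have conc: "concave_on {0..pi/4} sin"
    by (rule f''_le0_imp_concave[where f' = cos and f'' = "\<lambda>x. - sin x"])
       (auto intro!: derivative_eq_intros sin_ge_zero)
  have "(1 - 2*y) * sin 0 + 2*y * sin (pi/4) \<le> sin ((1 - 2*y) *\<^sub>R 0 + (2*y) *\<^sub>R (pi/4))"
    using concave_onD[OF conc, of "2*y" 0 "pi/4"] assms by simp
  then have "sqrt 2 * y \<le> sin (pi * y / 2)"
    by (simp add: sin_45 mult_ac)
  then have "(sqrt 2 * y)\<^sup>2 \<le> (sin (pi * y / 2))\<^sup>2"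
    using assms by (intro power_mono) auto
  moreover have "cos (pi * y) = 1 - 2 * (sin (pi * y / 2))\<^sup>2"
    using cos_double_sin[of "pi * y / 2"] by simp
  ultimately show ?thesis
    by (simp add: power_mult_distrib)
qed

lemma cos_add_cos_le:
  fixes a b :: real and d :: nat
  assumes "0 \<le> a" "a \<le> pi" "0 \<le> b" "b \<le> pi" "2 \<le> d" "2 * pi / d \<le> a + b"
  shows "cos a + cos b \<le> 2 - 8 / (real d)\<^sup>2"
proof -
  define y where "y = 1 / real d"
  have y: "0 \<le> y" "y \<le> 1/2"
    using assms by (auto simp: y_def field_simps)
  have cy: "0 \<le> cos (pi * y)"
    using y by (intro cos_ge_zero) (auto simp: field_simps intro: order.trans[of _ 0])
  have m: "cos ((a + b) / 2) \<le> cos (pi * y)"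
    using assms y by (intro cos_monotone_0_pi_le) (auto simp: y_def field_simps)
  have \<delta>: "0 \<le> cos ((a - b) / 2)" "cos ((a - b) / 2) \<le> 1"
    using assms by (auto intro!: cos_ge_zero)
  have "cos ((a + b) / 2) * cos ((a - b) / 2) \<le> cos (pi * y) * cos ((a - b) / 2)"
    using m \<delta> by (intro mult_right_mono)
  also have "\<dots> \<le> cos (pi * y)"
    using cy \<delta> by (simp add: mult_left_le)
  finally have "cos a + cos b \<le> 2 * cos (pi * y)"
    by (simp add: cos_plus_cos)
  also have "\<dots> \<le> 2 - 8 * y\<^sup>2"
    using cos_pi_mult_le[OF y] by simp
  finally show ?thesis
    by (simp add: y_def power_divide)
qed

lemma prod_cis: "(\<Prod>x\<in>A. cis (f x)) = cis (\<Sum>x\<in>A. f x)"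
  by (induction A rule: infinite_finite_induct) (auto simp: cis_mult)

section \<open>Underdetermined homogeneous linear systems\<close>

text \<open>Gaussian elimination: a vanishing equation is dropped, any other one removes a single
  unknown.\<close>

lemma underdetermined_system_nontrivial_solution:
  fixes a :: "'i \<Rightarrow> 'j \<Rightarrow> 'f :: field"
  assumes "finite E" "finite X" "card E < card X"
  shows "\<exists>x. (\<exists>j\<in>X. x j \<noteq> 0) \<and> (\<forall>i\<in>E. (\<Sum>j\<in>X. a i j * x j) = 0)"
  using assms
proof (induction E arbitrary: X a rule: finite_induct)
  case empty
  then have "X \<noteq> {}" by auto
  then show ?case by (intro exI[of _ "\<lambda>_. 1"]) auto
next
  case (insert e E)
  show ?case
  proof (cases "\<forall>j\<in>X. a e j = 0")
    case True
    obtain x where "\<exists>j\<in>X. x j \<noteq> 0" "\<forall>i\<in>E. (\<Sum>j\<in>X. a i j * x j) = 0"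
      using insert.IH[of X a] insert.prems insert.hyps by auto
    with True show ?thesis by (intro exI[of _ x]) auto
  next
    case False
    then obtain k where k: "k \<in> X" "a e k \<noteq> 0" by blast
    \<comment> \<open>Clears column \<open>k\<close> with the pivot \<open>a e k\<close>;
      \<open>z\<close> below is the back substitution from row \<open>e\<close>.\<close>
    define a' where "a' i j = a i j - a i k * a e j / a e k" for i j
    have "card E < card (X - {k})"
      using insert.prems insert.hyps k by simp
    with insert.IH[of "X - {k}" a'] insert.prems
    obtain x where x: "\<exists>j\<in>X - {k}. x j \<noteq> 0" "\<forall>i\<in>E. (\<Sum>j\<in>X - {k}. a' i j * x j) = 0"
      by auto
    define z where "z = - (\<Sum>j\<in>X - {k}. a e j * x j) / a e k"
    have split: "(\<Sum>j\<in>X. a i j * (x(k := z)) j) = a i k * z + (\<Sum>j\<in>X - {k}. a i j * x j)" for i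
      using insert.prems k by (subst sum.remove[of X k]) (auto intro!: sum.cong)
    have "(\<Sum>j\<in>X. a i j * (x(k := z)) j) = 0" if "i \<in> insert e E" for i
    proof (cases "i = e")
      case True
      with k show ?thesis unfolding split by (simp add: z_def)
    next
      case False
      with that x have "0 = (\<Sum>j\<in>X - {k}. a' i j * x j)" by simp
      also have "\<dots> = (\<Sum>j\<in>X - {k}. a i j * x j - (a i k / a e k) * (a e j * x j))"
        by (intro sum.cong) (auto simp: a'_def field_simps)
      also have "\<dots> = (\<Sum>j\<in>X - {k}. a i j * x j) + a i k * z"
        by (simp add: sum_subtractf sum_distrib_left sum_divide_distrib z_def)
      finally show ?thesis unfolding split by (simp add: add.commute)
    qed
    with x show ?thesis by (intro exI[of _ "x(k := z)"]) auto
  qed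
qed

section \<open>The graph Laplacian\<close>

definition laplacian :: "'a pair_pre_digraph \<Rightarrow> ('a \<Rightarrow> real) \<Rightarrow> 'a \<Rightarrow> real" where
  "laplacian G f v = (\<Sum>w\<in>neighbours G v. f v - f w)"

lemma laplacian_diff: "laplacian G (\<lambda>x. f x - g x) v = laplacian G f v - laplacian G g v"
  by (simp add: laplacian_def sum_subtractf[symmetric] algebra_simps)

lemma laplacian_eq: "laplacian G f v = real (vertex_degree G v) * f v - (\<Sum>w\<in>neighbours G v. f w)"
  by (simp add: laplacian_def vertex_degree_def sum_subtractf)

context pair_graph
begin

section \<open>Flux across vertex cuts and the maximum principle\<close>

lemma neighbours_subset: "neighbours G v \<subseteq> pverts G"
  by (auto simp: neighbours_def dest: in_arcsD2)

lemma finite_neighbours [simp]: "finite (neighbours G v)"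
  using neighbours_subset pair_finite_verts finite_subset by blast

text \<open>Discrete divergence theorem: opposite arcs inside \<open>S\<close> cancel, so only arcs
  leaving \<open>S\<close> contribute.\<close>

lemma sum_laplacian_eq_flux:
  assumes "S \<subseteq> pverts G"
  shows "(\<Sum>v\<in>S. laplacian G f v) = (\<Sum>v\<in>S. \<Sum>w\<in>neighbours G v - S. f v - f w)"
proof -
  have fin: "finite S"
    using assms pair_finite_verts finite_subset by blast
  \<comment> \<open>Extension by zero to all pairs lets the double sum over \<open>S\<close> be
    swapped; antisymmetry then gives \<open>T = - T\<close>.\<close>
  define e where "e v w = (if (v, w) \<in> parcs G then f v - f w else 0)" for v w
  define T where "T = (\<Sum>v\<in>S. \<Sum>w\<in>S. e v w)"
  have "T = (\<Sum>v\<in>S. \<Sum>w\<in>S. e w v)"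
    unfolding T_def by (rule sum.swap)
  also have "\<dots> = (\<Sum>v\<in>S. \<Sum>w\<in>S. - e v w)"
    by (intro sum.cong) (auto simp: e_def dest: arcs_symmetric)
  also have "\<dots> = - T"
    by (simp add: T_def sum_negf)
  finally have "T = 0" by simp
  have "laplacian G f v = (\<Sum>w\<in>neighbours G v - S. f v - f w) + (\<Sum>w\<in>S. e v w)" for v
  proof -
    have "(\<Sum>w\<in>S. e v w) = (\<Sum>w\<in>neighbours G v \<inter> S. f v - f w)"
      using fin by (intro sum.mono_neutral_cong_right) (auto simp: e_def neighbours_def)
    moreover have "laplacian G f v
        = (\<Sum>w\<in>neighbours G v - S. f v - f w) + (\<Sum>w\<in>neighbours G v \<inter> S. f v - f w)"
      unfolding laplacian_def by (subst sum.union_disjoint[symmetric]) (auto intro!: sum.cong)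
    ultimately show ?thesis by simp
  qed
  then have "(\<Sum>v\<in>S. laplacian G f v) = (\<Sum>v\<in>S. \<Sum>w\<in>neighbours G v - S. f v - f w) + T"
    by (simp add: sum.distrib T_def)
  with \<open>T = 0\<close> show ?thesis by simp
qed

lemma sum_laplacian: "(\<Sum>v\<in>pverts G. laplacian G f v) = 0"
proof -
  have "neighbours G v - pverts G = {}" for v
    using neighbours_subset by blast
  then show ?thesis by (simp only: sum_laplacian_eq_flux[OF subset_refl] sum.empty sum.neutral_const)
qed

text \<open>Every arc leaving a superlevel set goes downhill, so the flux has nonnegative terms and
  dominates each single drop.\<close>

lemma drop_le_superlevel_flux:
  fixes f :: "'a \<Rightarrow> real"
  assumes "x \<in> pverts G" "c \<le> f x" "(x, y) \<in> parcs G" "f y < c"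
  shows "f x - f y \<le> (\<Sum>v | v \<in> pverts G \<and> c \<le> f v. laplacian G f v)"
proof -
  let ?S = "{v \<in> pverts G. c \<le> f v}"
  have pos: "0 \<le> (\<Sum>w\<in>neighbours G v - ?S. f v - f w)" if "v \<in> ?S" for v
    using that neighbours_subset[of v] by (intro sum_nonneg) force
  have "f x - f y \<le> (\<Sum>w\<in>neighbours G x - ?S. f x - f w)"
    using assms neighbours_subset[of x]
    by (intro member_le_sum finite_Diff finite_neighbours) (force simp: neighbours_def)+
  also have "\<dots> \<le> (\<Sum>v\<in>?S. \<Sum>w\<in>neighbours G v - ?S. f v - f w)"
    using assms pair_finite_verts pos by (intro member_le_sum) auto
  also have "\<dots> = (\<Sum>v\<in>?S. laplacian G f v)"
    by (rule sum_laplacian_eq_flux[symmetric]) auto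
  finally show ?thesis .
qed

lemma connected_induct:
  assumes "Digraph_Component.connected (with_proj G)" "u \<in> pverts G" "v \<in> pverts G" "P u"
    and "\<And>x y. P x \<Longrightarrow> (x, y) \<in> parcs G \<Longrightarrow> P y"
  shows "P v"
proof -
  have "strongly_connected (with_proj G)"
    using assms(1) pair_sym_arcs symmetric_connected_imp_strongly_connected by blast
  then have "u \<rightarrow>\<^sup>*\<^bsub>with_proj G\<^esub> v"
    using assms by (auto simp: strongly_connected_def)
  then show ?thesis
    by (induction rule: reachable_induct) (use assms in auto)
qed

text \<open>Maximum principle: a drop along an arc is at most the flux out of a superlevel set, here
  a sum of zeros. The opposite arc gives equality, and connectedness spreads it.\<close>

lemma laplacian_zero_imp_constant:
  assumes conn: "Digraph_Component.connected (with_proj G)"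
    and harm: "\<And>v. v \<in> pverts G \<Longrightarrow> laplacian G f v = 0"
    and "u \<in> pverts G" "v \<in> pverts G"
  shows "f v = f u"
proof -
  have le: "f x \<le> f y" if "(x, y) \<in> parcs G" for x y
  proof (rule ccontr)
    assume "\<not> f x \<le> f y"
    with that have "f x - f y \<le> (\<Sum>v | v \<in> pverts G \<and> f x \<le> f v. laplacian G f v)"
      by (intro drop_le_superlevel_flux) (auto dest: in_arcsD1)
    also have "\<dots> = 0" using harm by simp
    finally show False using \<open>\<not> f x \<le> f y\<close> by simp
  qed
  have eq: "f x = f y" if "(x, y) \<in> parcs G" for x y
    using le[OF that] le[OF arcs_symmetric[OF that]] by simp
  show ?thesis
    using conn assms(3,4)
    by (rule connected_induct[where P = "\<lambda>x. f x = f u"]) (use eq in auto)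
qed


text \<open>The equations away from \<open>s\<close> number one less than the unknowns, hence have a
  nonzero solution; dividing by \<open>x s\<close> normalises the right-hand side.\<close>

lemma poisson_equation_solvable:
  assumes conn: "Digraph_Component.connected (with_proj G)"
    and "s \<in> pverts G" and b: "(\<Sum>v\<in>pverts G. b v) = 0"
  shows "\<exists>f. \<forall>v\<in>pverts G. laplacian G f v = b v"
proof -
  note fin = pair_finite_verts
  \<comment> \<open>Grounding \<open>f s = 0\<close> frees the slot \<open>s\<close>, which holds the coefficient of the right-hand side.\<close>
  define a where "a v w = (if w = s then - b v
    else (if w = v then real (vertex_degree G v) else 0) - (if w \<in> neighbours G v then 1 else 0))" for v w
  have "card (pverts G - {s}) < card (pverts G)"
    using fin \<open>s \<in> pverts G\<close> by (metis card_Diff1_less)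
  from underdetermined_system_nontrivial_solution[OF _ fin this, of a]
  obtain x where x: "\<exists>j\<in>pverts G. x j \<noteq> 0"
      "\<And>v. v \<in> pverts G - {s} \<Longrightarrow> (\<Sum>w\<in>pverts G. a v w * x w) = 0"
    using fin by auto
  define g where "g = x(s := 0)"
  have lap: "laplacian G g v = b v * x s" if "v \<in> pverts G - {s}" for v
  proof -
    have "(\<Sum>w\<in>pverts G. a v w * x w) = (\<Sum>w\<in>pverts G.
        (if w = s then - b v * x s else 0) + (if w = v then vertex_degree G v * g v else 0)
        - (if w \<in> neighbours G v then g w else 0))"
      using that by (intro sum.cong) (auto simp: a_def g_def algebra_simps)
    also have "\<dots> = - b v * x s + vertex_degree G v * g v - (\<Sum>w\<in>neighbours G v. g w)"
      using that fin \<open>s \<in> pverts G\<close> neighbours_subset[of v]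
      by (simp add: sum.distrib sum_subtractf sum.inter_restrict[symmetric] Int_absorb1)
    finally show ?thesis
      using x(2)[OF that] by (simp add: laplacian_eq)
  qed
  \<comment> \<open>The omitted equation at \<open>s\<close> follows, since both sides sum to zero
    over all vertices.\<close>
  have lap_s: "laplacian G g s = b s * x s"
  proof -
    have "laplacian G g s = - (\<Sum>v\<in>pverts G - {s}. laplacian G g v)"
      using sum_laplacian[of g] fin \<open>s \<in> pverts G\<close> by (simp add: sum.remove[of _ s])
    also have "\<dots> = - (\<Sum>v\<in>pverts G - {s}. b v) * x s"
      by (simp add: lap sum_distrib_right)
    also have "- (\<Sum>v\<in>pverts G - {s}. b v) = b s"
      using b fin \<open>s \<in> pverts G\<close> by (simp add: sum.remove[of _ s])
    finally show ?thesis .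
  qed
  have lap': "laplacian G g v = b v * x s" if "v \<in> pverts G" for v
    using lap lap_s that by (cases "v = s") auto
  \<comment> \<open>Otherwise \<open>g\<close> is harmonic and vanishes at \<open>s\<close>, which
    forces \<open>x\<close> to be zero on all vertices.\<close>
  have "x s \<noteq> 0"
  proof
    assume "x s = 0"
    then have "g v = g s" if "v \<in> pverts G" for v
      using laplacian_zero_imp_constant[OF conn, of g s v] lap' that \<open>s \<in> pverts G\<close> by simp
    then have "x v = 0" if "v \<in> pverts G" for v
      using that \<open>x s = 0\<close> by (cases "v = s") (force simp: g_def)+
    with x(1) show False by blast
  qed
  then have "laplacian G (\<lambda>v. g v / x s) v = b v" if "v \<in> pverts G" for v
    using lap'[OF that] by (simp add: laplacian_def diff_divide_distrib[symmetric] sum_divide_distrib[symmetric])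
  then show ?thesis by blast
qed

section \<open>Cycles and nonintegral potentials\<close>

lemma awalk_crosses_cut:
  assumes "awalk v q u" "v \<notin> S" "u \<in> S"
  shows "\<exists>(y, x)\<in>set q. y \<notin> S \<and> x \<in> S"
  using assms
proof (induction q arbitrary: v)
  case Nil
  then show ?case by (auto simp: awalk_Nil_iff)
next
  case (Cons e q)
  then show ?case
    by (cases "snd e \<in> S") (force simp: awalk_Cons_iff)+
qed

text \<open>
  A unit current through the edge \<open>uv\<close> of a cycle produces a potential difference strictly
  between 0 and 1: an integral potential would send at least one unit through every edge across
  the cut at level \<open>f u\<close>, so that \<open>uv\<close> would be the only such edge, hence a bridge.
\<close>
lemma cycle_imp_nonintegral_potential:
  assumes conn: "Digraph_Component.connected (with_proj G)"
    and cyc: "pre_digraph.cycle (with_proj G) p" "3 \<le> length p"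
  shows "\<exists>u\<in>pverts G. \<exists>v\<in>pverts G. \<forall>f.
    (\<forall>x\<in>pverts G. laplacian G f x = of_bool (x = u) - of_bool (x = v)) \<longrightarrow>
    (\<exists>x\<in>pverts G. f x \<notin> \<int>)"
proof -
  from cyc obtain u where u: "awalk u p u" "distinct (tl (awalk_verts u p))"
    by (auto simp: cycle_def)
  from cyc u obtain v q where p: "p = (u, v) # q"
    by (cases p) (auto simp: awalk_Cons_iff)
  have uv: "(u, v) \<in> parcs G" and q: "awalk v q u" "distinct (awalk_verts v q)" "2 \<le> length q"
    using u p cyc(2) by (auto simp: awalk_Cons_iff)
  have V: "u \<in> pverts G" "v \<in> pverts G" "u \<noteq> v"
    using uv by (auto dest: in_arcsD1 in_arcsD2 no_loops')
  \<comment> \<open>The rest \<open>q\<close> of the cycle repeats no vertex, so containing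
    \<open>(v, u)\<close> would reduce it to that single arc, against its length.\<close>
  have "(v, u) \<notin> set q"
  proof
    assume "(v, u) \<in> set q"
    then obtain q1 q2 where q12: "q = q1 @ (v, u) # q2"
      by (meson split_list)
    have ap: "apath v q u" using q by (simp add: apath_def)
    then have "apath v q1 v" "apath u q2 u"
      using q12 by (auto simp: apath_append_iff apath_Cons_iff)
    then have "q1 = []" "q2 = []"
      using apath_nonempty_ends by blast+
    with q12 q(3) show False by simp
  qed
  have "\<exists>x\<in>pverts G. f x \<notin> \<int>"
    if f: "\<forall>x\<in>pverts G. laplacian G f x = of_bool (x = u) - of_bool (x = v)" for f
  proof (rule ccontr)
    assume "\<not> ?thesis"
    then have int: "f x \<in> \<int>" if "x \<in> pverts G" for x
      using that by blast
    define S where "S = {x \<in> pverts G. f u \<le> f x}"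
    have fS: "finite S" "S \<subseteq> pverts G" "u \<in> S"
      using pair_finite_verts V by (auto simp: S_def)
    have "(\<Sum>x\<in>S. laplacian G f x) = (\<Sum>x\<in>S. of_bool (x = u) - of_bool (x = v))"
      using f fS by (intro sum.cong) auto
    then have total: "(\<Sum>x\<in>S. laplacian G f x) = 1 - of_bool (v \<in> S)"
      using fS by (simp add: sum_subtractf of_bool_def)
    have drop: "1 \<le> f x - f y" if "x \<in> S" "y \<notin> S" "(x, y) \<in> parcs G" for x y
    proof -
      have "f y < f x" "y \<in> pverts G" "x \<in> pverts G"
        using that by (auto simp: S_def dest: in_arcsD2)
      then show ?thesis
        using int[of x] int[of y] by (auto elim!: Ints_cases)
    qed
    have flux: "(\<Sum>x\<in>S. \<Sum>y\<in>neighbours G x - S. f x - f y) = 1 - of_bool (v \<in> S)"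
      using total sum_laplacian_eq_flux[OF fS(2)] by simp
    have cross: "(\<Sum>(x, y)\<in>(SIGMA x:S. neighbours G x - S). f x - f y) = 1 - of_bool (v \<in> S)"
      using flux fS by (simp add: sum.Sigma)
    \<comment> \<open>By integrality each arc out of \<open>S\<close> carries at least one unit, so
      the flux bounds their number.\<close>
    have count: "card (SIGMA x:S. neighbours G x - S) \<le> 1 - (of_bool (v \<in> S) :: real)"
    proof -
      have "card (SIGMA x:S. neighbours G x - S) = (\<Sum>_\<in>(SIGMA x:S. neighbours G x - S). 1 :: real)"
        by simp
      also have "\<dots> \<le> (\<Sum>(x, y)\<in>(SIGMA x:S. neighbours G x - S). f x - f y)"
        using drop by (intro sum_mono) (auto simp: neighbours_def)
      finally show ?thesis using cross by simp
    qed
    have finC: "finite (SIGMA x:S. neighbours G x - S)"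
      using fS by auto
    show False
    proof (cases "v \<in> S")
      case True
      \<comment> \<open>No arc leaves \<open>S\<close>, so \<open>S\<close> is everything and
        \<open>u\<close> minimises \<open>f\<close>, against
        \<open>laplacian G f u = 1\<close>.\<close>
      then have "card (SIGMA x:S. neighbours G x - S) = 0"
        using count by simp
      with finC have empty: "(SIGMA x:S. neighbours G x - S) = {}"
        by simp
      have "S = pverts G"
      proof
        show "pverts G \<subseteq> S"
        proof
          fix x assume "x \<in> pverts G"
          with conn V(1) show "x \<in> S"
            by (rule connected_induct) (use empty fS in \<open>auto simp: neighbours_def\<close>)
        qed
      qed (use fS in auto)
      then have min: "f u \<le> f x" if "x \<in> pverts G" for x
        using that by (auto simp: S_def)
      have "laplacian G f u \<le> 0"
        unfolding laplacian_def using min neighbours_subset by (intro sum_nonpos) force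
      with f V show False by simp
    next
      case False
      \<comment> \<open>The return path enters \<open>S\<close>. The reverse of the entering arc
        leaves \<open>S\<close>, so it must be \<open>(u, v)\<close>, the only arc the count allows;
        but \<open>q\<close> avoids \<open>(v, u)\<close>.\<close>
      obtain y x where yx: "(y, x) \<in> set q" "y \<notin> S" "x \<in> S"
        using awalk_crosses_cut[OF q(1) False fS(3)] by auto
      have "(y, x) \<in> parcs G" using yx q by (auto simp: awalk_def)
      then have "{(u, v), (x, y)} \<subseteq> (SIGMA x:S. neighbours G x - S)"
        using uv False fS yx by (auto simp: neighbours_def dest: arcs_symmetric)
      then have "card {(u, v), (x, y)} \<le> card (SIGMA x:S. neighbours G x - S)"
        using finC card_mono by blast
      then have "card {(u, v), (x, y)} \<le> 1"
        using count False by simp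
      then have "(x, y) = (u, v)"
        by (auto simp: card_insert_if split: if_splits)
      with yx \<open>(v, u) \<notin> set q\<close> show False by simp
    qed
  qed
  with V show ?thesis by blast
qed

section \<open>Multiplicative harmonic functions\<close>

text \<open>The phase \<omega> occurs \<open>vertex_degree G v\<close> times on both sides and
  cancels, leaving \<open>cis (laplacian G \<theta> v) = 1\<close>. This covers plain arguments,
  rotated arguments and scaled potentials alike.\<close>

lemma mult_harmonic_at_iff_laplacian:
  assumes h: "\<And>x. x \<in> pverts G \<Longrightarrow> h x = \<omega> * cis (\<theta> x)" and "\<omega> \<noteq> 0" "v \<in> pverts G"
  shows "h v ^ vertex_degree G v = (\<Prod>w\<in>neighbours G v. h w)
    \<longleftrightarrow> (\<exists>k :: int. laplacian G \<theta> v = k * (2 * pi))"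
proof -
  have "(\<Prod>w\<in>neighbours G v. h w) = (\<Prod>w\<in>neighbours G v. \<omega> * cis (\<theta> w))"
    using h neighbours_subset by (intro prod.cong) auto
  also have "\<dots> = \<omega> ^ vertex_degree G v * cis (\<Sum>w\<in>neighbours G v. \<theta> w)"
    by (simp add: prod.distrib prod_cis vertex_degree_def)
  finally have "h v ^ vertex_degree G v = (\<Prod>w\<in>neighbours G v. h w)
      \<longleftrightarrow> cis (vertex_degree G v * \<theta> v) = cis (\<Sum>w\<in>neighbours G v. \<theta> w)"
    using assms by (simp add: power_mult_distrib DeMoivre)
  also have "\<dots> \<longleftrightarrow> cis (laplacian G \<theta> v) = 1"
    by (simp add: laplacian_eq cis_divide[symmetric])
  finally show ?thesis
    by (simp add: cis_eq_1_iff)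
qed

lemma mult_harmonic_laplacian_cases:
  assumes "h \<in> mult_harmonic G s" "\<And>x. x \<in> pverts G \<Longrightarrow> h x = \<omega> * cis (\<theta> x)" "\<omega> \<noteq> 0" "v \<in> pverts G"
  obtains k :: int where "laplacian G \<theta> v = k * (2 * pi)"
  using mult_harmonic_at_iff_laplacian[of h \<omega> \<theta> v] assms by (auto simp: mult_harmonic_def)

lemma finite_mult_harmonic:
  assumes conn: "Digraph_Component.connected (with_proj G)" and s: "s \<in> pverts G"
  shows "finite (mult_harmonic G s)"
proof -
  \<comment> \<open>Restriction places the image in an extensional function space, finite because
    \<open>R\<close> is.\<close>
  define \<Phi> where "\<Phi> h = restrict (laplacian G (\<lambda>x. Arg (h x))) (pverts G)" for h :: "'a \<Rightarrow> complex"
  define R where "R = (\<lambda>k :: int. k * (2 * pi)) ` {- int (card (pverts G)) .. card (pverts G)}"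
  have lift: "h x = 1 * cis (Arg (h x))" if "h \<in> mult_harmonic G s" "x \<in> pverts G" for h x
  proof -
    have "cmod (h x) = 1" using that by (auto simp: mult_harmonic_def PiE_def Pi_def)
    then show ?thesis using cis_Arg[of "h x"] by (cases "h x = 0") (auto simp: sgn_eq)
  qed
  have "\<Phi> ` mult_harmonic G s \<subseteq> pverts G \<rightarrow>\<^sub>E R"
  proof (intro image_subsetI PiE_I)
    fix h v assume h: "h \<in> mult_harmonic G s" and v: "v \<in> pverts G"
    obtain k :: int where k: "laplacian G (\<lambda>x. Arg (h x)) v = k * (2 * pi)"
      using mult_harmonic_laplacian_cases[OF h lift[OF h] _ v] by auto
    have "\<bar>k * (2 * pi)\<bar> \<le> (\<Sum>w\<in>neighbours G v. \<bar>Arg (h v) - Arg (h w)\<bar>)"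
      unfolding k[symmetric] laplacian_def by (rule sum_abs)
    also have "\<dots> \<le> (\<Sum>w\<in>neighbours G v. 2 * pi)"
      by (intro sum_mono) (use Arg_bounded[of "h v"] Arg_bounded in \<open>smt (verit)\<close>)
    also have "\<dots> = card (neighbours G v) * (2 * pi)" by simp
    also have "\<dots> \<le> card (pverts G) * (2 * pi)"
      using card_mono[OF pair_finite_verts neighbours_subset] by simp
    finally have "\<bar>real_of_int k\<bar> \<le> card (pverts G)"
      by (simp add: abs_mult)
    then have "k \<in> {- int (card (pverts G)) .. card (pverts G)}" by auto
    with k v show "\<Phi> h v \<in> R" by (auto simp: \<Phi>_def R_def)
  qed (auto simp: \<Phi>_def)
  moreover have "finite (pverts G \<rightarrow>\<^sub>E R)"
    using pair_finite_verts by (intro finite_PiE) (auto simp: R_def)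
  moreover have "inj_on \<Phi> (mult_harmonic G s)"
  proof (rule inj_onI)
    fix h h' assume h: "h \<in> mult_harmonic G s" and h': "h' \<in> mult_harmonic G s" and eq: "\<Phi> h = \<Phi> h'"
    \<comment> \<open>Equal Laplacians make \<open>D\<close> harmonic, hence constant;
      \<open>h s = h' s = 1\<close> fixes the constant at 0.\<close>
    define D where "D x = Arg (h x) - Arg (h' x)" for x
    have "laplacian G D v = 0" if "v \<in> pverts G" for v
      using fun_cong[OF eq, of v] that by (simp add: D_def[abs_def] laplacian_diff \<Phi>_def)
    moreover have "D s = 0"
      using h h' by (simp add: D_def mult_harmonic_def)
    ultimately have "Arg (h x) = Arg (h' x)" if "x \<in> pverts G" for x
      using laplacian_zero_imp_constant[OF conn, of D s x] s that by (simp add: D_def)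
    then have "h x = h' x" if "x \<in> pverts G" for x
      using lift[OF h that] lift[OF h' that] that by simp
    with h h' show "h = h'"
      by (auto simp: mult_harmonic_def intro: PiE_ext)
  qed
  ultimately show ?thesis
    by (meson finite_imageD finite_subset)
qed

lemma nontrivial_mult_harmonic_exists:
  assumes conn: "Digraph_Component.connected (with_proj G)" and s: "s \<in> pverts G"
    and "pre_digraph.cycle (with_proj G) p" "3 \<le> length p"
  shows "\<exists>h\<in>mult_harmonic G s. \<exists>v\<in>pverts G. h v \<noteq> 1"
proof -
  obtain u v where uv: "u \<in> pverts G" "v \<in> pverts G"
    and nonint: "\<And>f. (\<And>x. x \<in> pverts G \<Longrightarrow> laplacian G f x = of_bool (x = u) - of_bool (x = v)) \<Longrightarrow>
      \<exists>x\<in>pverts G. f x \<notin> \<int>"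
    using cycle_imp_nonintegral_potential[OF conn assms(3,4)] by blast
  have "(\<Sum>x\<in>pverts G. of_bool (x = u) - of_bool (x = v) :: real) = 0"
    using uv pair_finite_verts by (simp add: sum_subtractf of_bool_def)
  from poisson_equation_solvable[OF conn s this]
  obtain g where g: "\<And>x. x \<in> pverts G \<Longrightarrow> laplacian G g x = of_bool (x = u) - of_bool (x = v)"
    by blast
  \<comment> \<open>The shift preserves the Laplacian and makes \<open>f s = 0\<close>, whence
    \<open>h s = 1\<close>.\<close>
  define f where "f x = g x - g s" for x
  have f: "laplacian G f x = of_bool (x = u) - of_bool (x = v)" if "x \<in> pverts G" for x
    using g[OF that] by (simp add: laplacian_def f_def)
  define h where "h = (\<lambda>x\<in>pverts G. cis (2 * pi * f x))"
  have "h x ^ vertex_degree G x = (\<Prod>w\<in>neighbours G x. h w)" if x: "x \<in> pverts G" for x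
  proof -
    have "laplacian G (\<lambda>x. 2 * pi * f x) x = (2 * pi) * laplacian G f x"
      by (simp add: laplacian_def sum_distrib_left algebra_simps)
    also have "\<dots> = of_int (of_bool (x = u) - of_bool (x = v)) * (2 * pi)"
      using f[OF x] by simp
    finally have "\<exists>k :: int. laplacian G (\<lambda>x. 2 * pi * f x) x = k * (2 * pi)" ..
    then show ?thesis
      using mult_harmonic_at_iff_laplacian[of h 1 "\<lambda>x. 2 * pi * f x" x] x by (simp add: h_def)
  qed
  then have "h \<in> mult_harmonic G s"
    using s by (auto simp: mult_harmonic_def h_def f_def)
  moreover obtain x where x: "x \<in> pverts G" "f x \<notin> \<int>"
    using nonint[OF f] by blast
  moreover have "h x \<noteq> 1"
  proof
    assume "h x = 1"
    then obtain k :: int where "2 * pi * f x = k * (2 * pi)"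
      using x by (auto simp: h_def cis_eq_1_iff)
    then have "f x = k" by simp
    with x show False by simp
  qed
  ultimately show ?thesis by blast
qed


section \<open>The spectral gap\<close>

text \<open>Positions count from 0, so \<open>d\<close> is the second largest degree and only the
  last entry of the sorted list can exceed it.\<close>

lemma degree_le_second_largest:
  assumes "u \<in> pverts G" "v \<in> pverts G" "u \<noteq> v"
  defines "d \<equiv> degree_sequence G ! (card (pverts G) - 2)"
  shows "vertex_degree G u \<le> d \<or> vertex_degree G v \<le> d"
proof (rule ccontr)
  assume "\<not> ?thesis"
  then have large: "d < vertex_degree G u" "d < vertex_degree G v" by auto
  define L where "L = degree_sequence G"
  define n where "n = card (pverts G)"
  have L: "sorted L" "mset L = image_mset (vertex_degree G) (mset_set (pverts G))"
    by (simp_all add: L_def degree_sequence_def)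
  have len: "length L = n"
    using arg_cong[OF L(2), of size] by (simp add: n_def)
  have "card {u, v} \<le> n"
    unfolding n_def using assms pair_finite_verts by (intro card_mono) auto
  then have n2: "2 \<le> n" using assms by simp
  have "L ! i \<le> d" if "i < n - 1" for i
    using that L(1) len n2
    by (auto simp: assms(4) L_def[symmetric] n_def[symmetric] intro!: sorted_nth_mono)
  then have small: "filter (\<lambda>k. d < k) (take (n - 1) L) = []"
    using len by (auto simp: filter_empty_conv in_set_conv_nth not_less)
  have "card {u, v} \<le> card {x \<in> pverts G. d < vertex_degree G x}"
    using large assms pair_finite_verts by (intro card_mono) auto
  also have "\<dots> = size (filter_mset (\<lambda>k. d < k) (mset L))"
    by (simp add: L(2) filter_mset_image_mset)
  also have "\<dots> = length (filter (\<lambda>k. d < k) (take (n - 1) L @ drop (n - 1) L))"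
    by (metis append_take_drop_id mset_filter size_mset)
  also have "\<dots> = length (filter (\<lambda>k. d < k) (drop (n - 1) L))"
    by (simp only: filter_append small append_Nil)
  also have "\<dots> \<le> length (drop (n - 1) L)"
    by (rule length_filter_le)
  also have "\<dots> = 1" using len n2 by simp
  finally show False using assms by simp
qed

lemma nontrivial_eigenvalue_bound:
  assumes conn: "Digraph_Component.connected (with_proj G)" and s: "s \<in> pverts G"
    and h: "h \<in> mult_harmonic G s" and nontriv: "\<exists>v\<in>pverts G. h v \<noteq> 1"
  defines "n \<equiv> card (pverts G)"
  defines "d \<equiv> degree_sequence G ! (n - 2)"
  shows "8 / ((real d)\<^sup>2 * n) \<le> 1 - cmod (sandpile_eigenvalue G h)"
proof -
  let ?V = "pverts G"
  have n: "0 < n" using s pair_finite_verts by (auto simp: n_def card_gt_0_iff)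
  \<comment> \<open>If the sum vanishes, \<open>Arg 0 = 0\<close> gives \<omega> = 1, and the
    computation of the modulus below still holds.\<close>
  define \<omega> where "\<omega> = cis (Arg (\<Sum>v\<in>?V. h v))"
  define \<theta> where "\<theta> v = Arg (h v / \<omega>)" for v
  have \<omega>: "cmod \<omega> = 1" "\<omega> \<noteq> 0" by (auto simp: \<omega>_def)
  have \<theta>_bounds: "- pi < \<theta> v" "\<theta> v \<le> pi" for v
    using Arg_bounded[of "h v / \<omega>"] by (auto simp: \<theta>_def)
  have lift: "h v = \<omega> * cis (\<theta> v)" if "v \<in> ?V" for v
  proof -
    have "cmod (h v) = 1" using h that by (auto simp: mult_harmonic_def PiE_def Pi_def)
    then have "cmod (h v / \<omega>) = 1" using \<omega> by (simp add: norm_divide)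
    then have "cis (\<theta> v) = h v / \<omega>"
      unfolding \<theta>_def using cis_Arg[of "h v / \<omega>"] by (cases "h v / \<omega> = 0") (auto simp: sgn_eq)
    then show ?thesis using \<omega> by simp
  qed
  have sum_cos: "cmod (\<Sum>v\<in>?V. h v) = (\<Sum>v\<in>?V. cos (\<theta> v))"
  proof -
    have "cmod (\<Sum>v\<in>?V. h v) * \<omega> = (\<Sum>v\<in>?V. h v)"
      using rcis_cmod_Arg[of "\<Sum>v\<in>?V. h v"] by (simp add: rcis_def \<omega>_def)
    also have "\<dots> = (\<Sum>v\<in>?V. cis (\<theta> v)) * \<omega>"
      using lift by (simp add: sum_distrib_left mult.commute)
    finally have "complex_of_real (cmod (\<Sum>v\<in>?V. h v)) = (\<Sum>v\<in>?V. cis (\<theta> v))"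
      using \<omega> by simp
    from arg_cong[OF this, of Re] show ?thesis by simp
  qed
  have "\<exists>u\<in>?V. laplacian G \<theta> u \<noteq> 0"
  proof (rule ccontr)
    assume "\<not> ?thesis"
    then have "\<theta> v = \<theta> s" if "v \<in> ?V" for v
      using laplacian_zero_imp_constant[OF conn _ s that, of \<theta>] by blast
    then have "h v = h s" if "v \<in> ?V" for v
      using lift[OF that] lift[OF s] that by simp
    moreover have "h s = 1" using h by (simp add: mult_harmonic_def)
    ultimately show False using nontriv by simp
  qed
  then obtain u where u: "u \<in> ?V" "laplacian G \<theta> u \<noteq> 0" by blast
  have "\<exists>u'\<in>?V. u' \<noteq> u \<and> laplacian G \<theta> u' \<noteq> 0"
  proof (rule ccontr)
    assume "\<not> ?thesis"
    then have "(\<Sum>v\<in>?V - {u}. laplacian G \<theta> v) = 0"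
      by (intro sum.neutral) blast
    with u sum_laplacian[of \<theta>] pair_finite_verts show False
      by (simp add: sum.remove[of _ u])
  qed
  then obtain u' where u': "u' \<in> ?V" "u' \<noteq> u" "laplacian G \<theta> u' \<noteq> 0" by blast
  obtain v where v: "v \<in> ?V" "laplacian G \<theta> v \<noteq> 0" "vertex_degree G v \<le> d"
    using degree_le_second_largest[OF u(1) u'(1)] u u' unfolding d_def n_def by blast
  define m where "m = vertex_degree G v"
  have ne: "neighbours G v \<noteq> {}"
    using v(2) by (auto simp: laplacian_def)
  then have m0: "0 < m"
    by (simp add: m_def vertex_degree_def card_gt_0_iff)
  obtain k :: int where k: "laplacian G \<theta> v = k * (2 * pi)"
    using mult_harmonic_laplacian_cases[OF h lift \<omega>(2) v(1)] by blast
  have "1 \<le> \<bar>real_of_int k\<bar>" using k v by auto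
  then have lap_ge: "2 * pi \<le> \<bar>laplacian G \<theta> v\<bar>"
    by (simp add: k abs_mult)
  \<comment> \<open>Averaging: \<open>m\<close> differences have total absolute value at least
    \<open>2 * pi\<close>.\<close>
  have "\<exists>w\<in>neighbours G v. 2 * pi / m \<le> \<bar>\<theta> v - \<theta> w\<bar>"
  proof (rule ccontr)
    assume "\<not> ?thesis"
    then have "(\<Sum>w\<in>neighbours G v. \<bar>\<theta> v - \<theta> w\<bar>) < (\<Sum>w\<in>neighbours G v. 2 * pi / m)"
      by (intro sum_strict_mono finite_neighbours ne) auto
    also have "\<dots> = 2 * pi"
      using ne by (simp add: m_def vertex_degree_def)
    finally show False
      using lap_ge sum_abs[of "\<lambda>w. \<theta> v - \<theta> w" "neighbours G v"] by (simp add: laplacian_def)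
  qed
  then obtain w where w: "w \<in> neighbours G v" "2 * pi / m \<le> \<bar>\<theta> v - \<theta> w\<bar>" by blast
  then have wV: "w \<in> ?V" "v \<noteq> w"
    using neighbours_subset by (auto simp: neighbours_def dest: no_loops')
  \<comment> \<open>The range of \<theta> is half-open, so differences stay strictly below
    \<open>2 * pi\<close>; this excludes \<open>m = 1\<close>.\<close>
  have "2 * pi / m < 2 * pi"
    using w(2) \<theta>_bounds[of v] \<theta>_bounds[of w] by linarith
  then have m2: "2 \<le> m"
    using m0 by (cases "m = 1") auto
  \<comment> \<open>Cosine is even, and the absolute values add up to at least
    \<open>\<bar>\<theta> v - \<theta> w\<bar>\<close>.\<close>
  have "cos \<bar>\<theta> v\<bar> + cos \<bar>\<theta> w\<bar> \<le> 2 - 8 / (real m)\<^sup>2"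
    using w(2) m2 \<theta>_bounds[of v] \<theta>_bounds[of w] by (intro cos_add_cos_le) linarith+
  then have "8 / (real m)\<^sup>2 \<le> (\<Sum>x\<in>{v, w}. 1 - cos (\<theta> x))"
    using wV by simp
  also have "\<dots> \<le> (\<Sum>x\<in>?V. 1 - cos (\<theta> x))"
    using v wV pair_finite_verts by (intro sum_mono2) auto
  also have "\<dots> = n - cmod (\<Sum>x\<in>?V. h x)"
    by (simp add: sum_subtractf sum_cos n_def)
  finally have gap: "8 / (real m)\<^sup>2 \<le> n - cmod (\<Sum>x\<in>?V. h x)" .
  have "8 / (real d)\<^sup>2 \<le> 8 / (real m)\<^sup>2"
    using v(3) m0 by (intro divide_left_mono power_mono) (auto simp: m_def)
  with gap have "8 / (real d)\<^sup>2 / n \<le> (n - cmod (\<Sum>x\<in>?V. h x)) / n"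
    by (intro divide_right_mono) auto
  also have "\<dots> = 1 - cmod (sandpile_eigenvalue G h)"
    using n by (simp add: sandpile_eigenvalue_def norm_mult norm_divide diff_divide_distrib n_def[symmetric])
  finally show ?thesis by simp
qed

end

theorem theorem2p11:
  fixes G :: "'a pair_pre_digraph" and s :: 'a and n d_star :: nat
  assumes "pair_graph G"
    and "Digraph_Component.connected (with_proj G)"
    and "\<not> undirected_tree G"
    and "s \<in> pverts G"
    and "n = card (pverts G)"
    and "d_star = degree_sequence G ! (n - 2)"
  shows "discrete_spectral_gap G s \<ge> 8 / (real d_star ^ 2 * real n)"
proof -
  interpret pair_graph G by fact
  let ?A = "{1 - cmod (sandpile_eigenvalue G h) | h.
    h \<in> mult_harmonic G s \<and> \<not> (\<forall>v\<in>pverts G. h v = 1)}"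
  have "?A \<subseteq> (\<lambda>h. 1 - cmod (sandpile_eigenvalue G h)) ` mult_harmonic G s"
    by auto
  then have "finite ?A"
    using finite_mult_harmonic[OF assms(2,4)] finite_surj by blast
  \<comment> \<open>The minimum needs a member; a connected graph that is not a tree has a cycle of
    length at least 3, which yields one.\<close>
  moreover have "?A \<noteq> {}"
  proof -
    obtain p where "pre_digraph.cycle (with_proj G) p" "3 \<le> length p"
      using assms(2,3) by (auto simp: undirected_tree_def)
    from nontrivial_mult_harmonic_exists[OF assms(2,4) this] show ?thesis by blast
  qed
  moreover have "8 / (real d_star ^ 2 * real n) \<le> x" if "x \<in> ?A" for x
    using that nontrivial_eigenvalue_bound[OF assms(2,4)] assms(5,6) by auto
  ultimately show ?thesis
    unfolding discrete_spectral_gap_def by (intro Min.boundedI)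
qed

end
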